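(* Let $X$ be a normal topological space such that $\nu_{LS}$ is a category on $X$. Then $\nu_{LS}=\overline{\nu}_H$, i.e. $\nu_{LS}(A)=\nu_H(\overline{A})$ for every subset $A\subset X$. In particular, if $X$ is an ANE, then $\nu_{LS}(A)=\nu_H(A)$ for every closed subset $A\subset X$.
   Context: Let $X$ be a topological space. A subset $A\subset X$ is contractible in $X$ if the inclusion map $A\to X$ is homotopic to a constant map. For $A\subset X$, $\nu_{LS}(A)$ is the minimum number of closed subsets of $X$, each contractible in $X$, required to cover $A$ ($+\infty$ if there is no finite such covering). For $A\subset X$, $\nu_H(A)=\nu_H(A,X)$ is the minimum number of open subsets of $X$, each contractible in $X$, required to cover $A$ ($+\infty$ if there is no finite such covering). The map $\overline{\nu}_H$ is defined by $\overline{\nu}_H(A)=\nu_H(\overline{A})$, where $\overline{A}$ is the closure of $A$ in $X$. A category on a topological space $X$ is a map $\nu:2^X\to\mathbb{Z}\cup\{+\infty\}$ such that: (i) if $A\subset B$ then $\nu(A)\le\nu(B)$; (ii) $\nu(A\cup B)\le\nu(A)+\nu(B)$; (iii) for every subset $A\subset X$ there is an open set $U\subset X$ with $A\subset U$ and $\nu(A)=\nu(U)$; (iv) if $f:X\to X$ is continuous and homotopic to $\mathrm{id}_X$, then $\nu(A)\le\nu(f(A))$ for every subset $A\subset X$. A metric space $X$ is an ANE (absolute neighborhood extensor) if for every metric space $Y$, every closed subset $B\subset Y$ and every continuous $f:B\to X$, there is a continuous extension of $f$ defined on a neighborhood of $B$ in $Y$. *)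

theory Defs
  imports "HOL-Analysis.Analysis" "HOL-Library.Extended_Nat"
begin

text \<open>Spaces are values \<open>X\<close> of type \<open>'a topology\<close>; subsets of the space are sets
  \<open>A \<subseteq> topspace X\<close>.\<close>

definition contractible_in :: "'a topology \<Rightarrow> 'a set \<Rightarrow> bool" where
  "contractible_in X A \<longleftrightarrow>
     A \<subseteq> topspace X \<and> (\<exists>c. homotopic_with (\<lambda>_. True) (subtopology X A) X id (\<lambda>_. c))"

text \<open>In \<^typ>\<open>enat\<close> the infimum of a nonempty set is its minimum and the infimum of the empty
  set is \<open>\<infinity>\<close>.\<close>

definition nu_LS :: "'a topology \<Rightarrow> 'a set \<Rightarrow> enat" where
  "nu_LS X A = Inf {enat (card F) | F.
     finite F \<and> (\<forall>C\<in>F. closedin X C \<and> contractible_in X C) \<and> A \<subseteq> \<Union>F}"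

definition nu_H :: "'a topology \<Rightarrow> 'a set \<Rightarrow> enat" where
  "nu_H X A = Inf {enat (card F) | F.
     finite F \<and> (\<forall>U\<in>F. openin X U \<and> contractible_in X U) \<and> A \<subseteq> \<Union>F}"

definition nu_H_bar :: "'a topology \<Rightarrow> 'a set \<Rightarrow> enat" where
  "nu_H_bar X A = nu_H X (X closure_of A)"

text \<open>The usual codomain is the integers with \<open>+\<infinity>\<close>. Nothing is lost with \<^typ>\<open>enat\<close>:
  subadditivity for \<open>A = B = {}\<close> gives \<open>\<nu> {} \<ge> 0\<close>, and then monotonicity makes
  every value nonnegative.\<close>

definition category_on :: "'a topology \<Rightarrow> ('a set \<Rightarrow> enat) \<Rightarrow> bool" where
  "category_on X \<nu> \<longleftrightarrow>
     (\<forall>A B. A \<subseteq> B \<and> B \<subseteq> topspace X \<longrightarrow> \<nu> A \<le> \<nu> B) \<and>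
     (\<forall>A B. A \<subseteq> topspace X \<and> B \<subseteq> topspace X \<longrightarrow> \<nu> (A \<union> B) \<le> \<nu> A + \<nu> B) \<and>
     (\<forall>A. A \<subseteq> topspace X \<longrightarrow> (\<exists>U. openin X U \<and> A \<subseteq> U \<and> \<nu> A = \<nu> U)) \<and>
     (\<forall>f. continuous_map X X f \<and> homotopic_with (\<lambda>_. True) X X f id \<longrightarrow>
        (\<forall>A. A \<subseteq> topspace X \<longrightarrow> \<nu> A \<le> \<nu> (f ` A)))"

text \<open>Absolute neighborhood extensors for metric spaces. The property depends only on the
  topologies involved, hence \<^const>\<open>metrizable_space\<close>. HOL cannot quantify over the type of
  the points of \<open>Y\<close>; here it is \<open>'a \<times> real\<close>, which yields the same notion as allowing
  all metric spaces. Indeed, \<open>X\<close> (if nonempty) embeds as a closed subset of a convex subset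
  \<open>C\<close> of a normed space, namely the convex hull of its Kuratowski image in the bounded
  functions on \<open>X\<close>. The set \<open>C\<close> has at most as many points as \<open>'a \<times> real\<close>, so
  it occurs, up to homeomorphism, among the \<open>Y\<close> below, and extending the identity of \<open>X\<close>
  gives a retraction onto \<open>X\<close> of a neighborhood of \<open>X\<close> in \<open>C\<close>. For an arbitrary metric
  space \<open>Y\<close>, a map from a closed subset into \<open>X\<close> extends to a map \<open>Y \<rightarrow> C\<close> by
  Dugundji's theorem, and composing with the retraction gives the required extension.\<close>

definition ANE :: "'a topology \<Rightarrow> bool" where
  "ANE X \<longleftrightarrow> metrizable_space X \<and>
     (\<forall>(Y :: ('a \<times> real) topology) B f.
        metrizable_space Y \<and> closedin Y B \<and> continuous_map (subtopology Y B) X f \<longrightarrow>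
        (\<exists>U g. openin Y U \<and> B \<subseteq> U \<and> continuous_map (subtopology Y U) X g \<and>
               (\<forall>y\<in>B. g y = f y)))"

end

theory Submission imports Defs begin

text \<open>Both parts compare the two covering numbers by replacing the members of a cover one at a time.
  In a normal space a finite open cover of a closed set shrinks to a closed cover, and subsets of
  contractible sets are contractible. Conversely, a closed contractible set has to be enlarged to
  an open contractible one. If \<open>\<nu>\<^sub>L\<^sub>S\<close> is a category, apply its continuity property to a closed
  contractible \<open>C\<close>: some open neighbourhood \<open>U\<close> of \<open>C\<close> has \<open>\<nu>\<^sub>L\<^sub>S(U) \<le> 1\<close>. If \<open>X\<close> is an ANE, extend
  the contracting homotopy from \<open>X \<times> {0} \<union> C \<times> [0,1] \<union> X \<times> {1}\<close> to a neighbourhood in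
  \<open>X \<times> [0,1]\<close>; by the tube lemma it contains some \<open>V \<times> [0,1]\<close> with \<open>V\<close> open around \<open>C\<close>.\<close>

section \<open>Covering numbers\<close>

text \<open>The closed and the open covering number are both instances, so a single comparison lemma
  serves both inequalities.\<close>

definition cover_number :: "('a set \<Rightarrow> bool) \<Rightarrow> 'a set \<Rightarrow> enat" where
  "cover_number P A = Inf {enat (card F) | F. finite F \<and> (\<forall>C\<in>F. P C) \<and> A \<subseteq> \<Union>F}"

lemma nu_LS_eq_cover_number:
  "nu_LS X = cover_number (\<lambda>C. closedin X C \<and> contractible_in X C)"
  by (simp add: fun_eq_iff nu_LS_def cover_number_def)

lemma nu_H_eq_cover_number:
  "nu_H X = cover_number (\<lambda>U. openin X U \<and> contractible_in X U)"
  by (simp add: fun_eq_iff nu_H_def cover_number_def)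

lemma cover_number_le_card:
  assumes "finite F" "\<And>C. C \<in> F \<Longrightarrow> P C" "A \<subseteq> \<Union>F"
  shows "cover_number P A \<le> enat (card F)"
  unfolding cover_number_def by (rule Inf_lower) (use assms in blast)

lemma cover_number_attained:
  assumes "cover_number P A \<noteq> \<infinity>"
  obtains F where "finite F" "\<And>C. C \<in> F \<Longrightarrow> P C" "A \<subseteq> \<Union>F"
    "cover_number P A = enat (card F)"
proof -
  let ?S = "{enat (card F) | F. finite F \<and> (\<forall>C\<in>F. P C) \<and> A \<subseteq> \<Union>F}"
  have "?S \<noteq> {}"
    using assms unfolding cover_number_def by (metis Inf_empty top_enat_def)
  then have "cover_number P A \<in> ?S"
    unfolding cover_number_def Inf_enat_def by (metis (no_types, lifting) LeastI ex_in_conv)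
  then show thesis
    using that by blast
qed

text \<open>A replacement of the members of a cover may merge some of them but never increases their
  number. The map \<open>g\<close> may depend on the whole cover \<open>F\<close>, as it does when
  an open cover is shrunk.\<close>

lemma cover_number_le_cover_number:
  assumes "\<And>F. \<lbrakk>finite F; \<forall>C\<in>F. P C; A \<subseteq> \<Union>F\<rbrakk> \<Longrightarrow> \<exists>g. (\<forall>C\<in>F. Q (g C)) \<and> B \<subseteq> \<Union>(g ` F)"
  shows "cover_number Q B \<le> cover_number P A"
proof (cases "cover_number P A = \<infinity>")
  case False
  then obtain F where F: "finite F" "\<forall>C\<in>F. P C" "A \<subseteq> \<Union>F" "cover_number P A = enat (card F)"
    by (metis cover_number_attained)
  obtain g where "\<forall>C\<in>F. Q (g C)" "B \<subseteq> \<Union>(g ` F)"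
    using assms[OF F(1-3)] by blast
  then have "cover_number Q B \<le> enat (card (g ` F))"
    using F(1) by (intro cover_number_le_card) auto
  also have "\<dots> \<le> cover_number P A"
    using F(1,4) by (simp add: card_image_le)
  finally show ?thesis .
qed simp

section \<open>Shrinking and enlarging covers\<close>

lemma contractible_in_subset:
  assumes "contractible_in X B" "A \<subseteq> B"
  shows "contractible_in X A"
proof -
  obtain c where "homotopic_with (\<lambda>_. True) (subtopology X B) X id (\<lambda>_. c)"
    using assms(1) by (auto simp: contractible_in_def)
  moreover have "continuous_map (subtopology X A) (subtopology X B) id"
    using assms(2) by (auto simp: continuous_map_in_subtopology continuous_map_from_subtopology)
  ultimately have "homotopic_with (\<lambda>_. True) (subtopology X A) X (id \<circ> id) ((\<lambda>_. c) \<circ> id)"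
    by (intro homotopic_with_compose_continuous_map_right) auto
  then show ?thesis
    using assms by (auto simp: contractible_in_def comp_def id_def)
qed

lemma contractible_in_empty: "contractible_in X {}"
  unfolding contractible_in_def by (auto intro!: exI homotopic_with_equal)

text \<open>Induction on the cover. The part of \<open>A\<close> that only \<open>U\<close> covers
  is closed, so normality puts an open \<open>W\<close> around it whose closure lies in
  \<open>U\<close>. What remains, \<open>A - W\<close>, is closed and covered by the other members,
  hence the induction over arbitrary \<open>A\<close>.\<close>

lemma normal_space_shrink_cover:
  assumes "normal_space X" "finite F" "\<forall>U\<in>F. openin X U" "closedin X A" "A \<subseteq> \<Union>F"
  shows "\<exists>C. (\<forall>U\<in>F. closedin X (C U) \<and> C U \<subseteq> U) \<and> A \<subseteq> \<Union>(C ` F)"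
  using assms(2-5)
proof (induction F arbitrary: A rule: finite_induct)
  case (insert U F)
  have "closedin X (A - \<Union>F)" "A - \<Union>F \<subseteq> U" "openin X U"
    using insert.prems by (auto intro!: closedin_diff)
  then obtain W where W: "openin X W" "A - \<Union>F \<subseteq> W" "X closure_of W \<subseteq> U"
    using assms(1) unfolding normal_space_alt by metis
  have "closedin X (A - W)" "A - W \<subseteq> \<Union>F"
    using insert.prems W by (auto intro!: closedin_diff)
  then obtain C where C: "\<forall>U\<in>F. closedin X (C U) \<and> C U \<subseteq> U" "A - W \<subseteq> \<Union>(C ` F)"
    using insert.IH[of "A - W"] insert.prems by auto
  have "W \<subseteq> X closure_of W"
    by (simp add: W(1) closure_of_subset openin_subset)
  then have "A \<subseteq> X closure_of W \<union> \<Union>(C ` F)"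
    using C(2) by blast
  moreover have "(C(U := X closure_of W)) ` insert U F = insert (X closure_of W) (C ` F)"
    using insert.hyps by auto
  ultimately have "A \<subseteq> \<Union>((C(U := X closure_of W)) ` insert U F)"
    by simp
  then show ?case
    using C(1) W(3) by (intro exI[of _ "C(U := X closure_of W)"]) auto
qed auto

lemma nu_LS_le_nu_H_bar:
  assumes "normal_space X" "A \<subseteq> topspace X"
  shows "nu_LS X A \<le> nu_H_bar X A"
  unfolding nu_H_bar_def nu_LS_eq_cover_number nu_H_eq_cover_number
proof (rule cover_number_le_cover_number)
  fix F
  assume F: "finite F" "\<forall>U\<in>F. openin X U \<and> contractible_in X U" "X closure_of A \<subseteq> \<Union>F"
  then obtain C where "\<forall>U\<in>F. closedin X (C U) \<and> C U \<subseteq> U" "X closure_of A \<subseteq> \<Union>(C ` F)"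
    using normal_space_shrink_cover[OF assms(1), of F "X closure_of A"] by auto
  moreover have "A \<subseteq> X closure_of A"
    by (simp add: assms(2) closure_of_subset)
  ultimately show "\<exists>C. (\<forall>U\<in>F. closedin X (C U) \<and> contractible_in X (C U)) \<and> A \<subseteq> \<Union>(C ` F)"
    using F(2) by (meson contractible_in_subset subset_trans)
qed

lemma nu_H_bar_le_nu_LS:
  assumes "\<And>C. \<lbrakk>closedin X C; contractible_in X C\<rbrakk> \<Longrightarrow> \<exists>U. openin X U \<and> C \<subseteq> U \<and> contractible_in X U"
  shows "nu_H_bar X A \<le> nu_LS X A"
  unfolding nu_H_bar_def nu_LS_eq_cover_number nu_H_eq_cover_number
proof (rule cover_number_le_cover_number)
  fix F
  assume F: "finite F" "\<forall>C\<in>F. closedin X C \<and> contractible_in X C" "A \<subseteq> \<Union>F"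
  obtain U where U: "\<forall>C\<in>F. openin X (U C) \<and> C \<subseteq> U C \<and> contractible_in X (U C)"
    using assms F(2) by metis
  \<comment> \<open>A finite union of closed sets is closed, so a closed cover of \<open>A\<close>
    already covers its closure.\<close>
  have "X closure_of A \<subseteq> \<Union>F"
    using F by (intro closure_of_minimal) (auto intro: closedin_Union)
  then show "\<exists>U. (\<forall>C\<in>F. openin X (U C) \<and> contractible_in X (U C)) \<and> X closure_of A \<subseteq> \<Union>(U ` F)"
    using U by (intro exI[of _ U]) blast
qed

section \<open>Open contractible neighbourhoods\<close>

lemma category_on_nu_LS_open_neighbourhood:
  assumes "category_on X (nu_LS X)" "closedin X C" "contractible_in X C"
  shows "\<exists>U. openin X U \<and> C \<subseteq> U \<and> contractible_in X U"
proof -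
  obtain U where U: "openin X U" "C \<subseteq> U" "nu_LS X C = nu_LS X U"
    using assms(1)[unfolded category_on_def, THEN conjunct2, THEN conjunct2, THEN conjunct1]
      closedin_subset[OF assms(2)] by metis
  have "nu_LS X C \<le> enat (card {C})"
    unfolding nu_LS_eq_cover_number using assms(2,3) by (intro cover_number_le_card) auto
  then have le: "nu_LS X U \<le> enat 1"
    using U(3) by simp
  then have "nu_LS X U \<noteq> \<infinity>"
    by (metis enat_ord_code(5))
  then obtain F where F: "finite F" "\<And>C. C \<in> F \<Longrightarrow> closedin X C \<and> contractible_in X C" "U \<subseteq> \<Union>F"
    "nu_LS X U = enat (card F)"
    unfolding nu_LS_eq_cover_number by (rule cover_number_attained) blast
  have "card F \<le> 1"
    using le F(4) by simp
  \<comment> \<open>At most one closed contractible set covers \<open>U\<close>. With no such set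
    \<open>U\<close> is empty; with one, \<open>U\<close> inherits contractibility as a
    subset.\<close>
  then have "F = {} \<or> (\<exists>D. F = {D})"
    using F(1) by (simp add: le_Suc_eq card_1_singleton_iff)
  then have "contractible_in X U"
  proof
    assume "F = {}"
    then show ?thesis
      using F(3) contractible_in_empty by auto
  next
    assume "\<exists>D. F = {D}"
    then show ?thesis
      using F(2,3) contractible_in_subset by (metis ccpo_Sup_singleton singletonI)
  qed
  then show ?thesis
    using U by blast
qed

text \<open>Projection along a compact factor is a closed map; apply it to the complement of
  \<open>U\<close>.\<close>

lemma openin_prod_topology_tube:
  assumes "compact_space Y" "openin (prod_topology X Y) U"
  shows "openin X {x \<in> topspace X. {x} \<times> topspace Y \<subseteq> U}"
proof -
  let ?Z = "prod_topology X Y"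
  have "closedin X (fst ` (topspace ?Z - U))"
    using closed_map_fst[OF assms(1)] assms(2) unfolding closed_map_def by blast
  moreover have "{x \<in> topspace X. {x} \<times> topspace Y \<subseteq> U} = topspace X - fst ` (topspace ?Z - U)"
    by (auto simp: image_iff Bex_def) blast
  ultimately show ?thesis
    by auto
qed

lemma ANE_open_neighbourhood:
  fixes X :: "'a topology"
  assumes "ANE X" "closedin X C" "contractible_in X C"
  shows "\<exists>V. openin X V \<and> C \<subseteq> V \<and> contractible_in X V"
\<comment> \<open>For empty \<open>C\<close> the constant of the contraction could lie outside
  \<open>X\<close>; a point of \<open>C\<close> forces \<open>c\<close> into
  \<open>topspace X\<close>.\<close>
proof (cases "C = {}")
  case True
  then show ?thesis
    by (intro exI[of _ "{}"]) (simp add: contractible_in_empty)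
next
  case False
  define I where "I = top_of_set {0..1::real}"
  \<comment> \<open>\<open>ANE\<close> asks for spaces on \<open>'a \<times> real\<close>, so time
    is the second coordinate here but the first in \<open>h\<close>; hence the swapped pairs
    below.\<close>
  define Y where "Y = prod_topology X I"
  have Itop: "topspace I = {0..1}" and Icomp: "compact_space I"
    by (auto simp: I_def compact_space_subtopology)
  have CX: "C \<subseteq> topspace X"
    using assms(2) closedin_subset by blast
  obtain c h where h: "continuous_map (prod_topology I (subtopology X C)) X h"
    and h0: "\<And>x. h (0, x) = x" and h1: "\<And>x. h (1, x) = c"
    using assms(3) unfolding contractible_in_def homotopic_with_def I_def by auto
  have c: "c \<in> topspace X"
    using continuous_map_image_subset_topspace[OF h] False CX h1 by (force simp: Itop)
  have "metrizable_space X"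
    using assms(1) by (simp add: ANE_def)
  then have metY: "metrizable_space Y"
    unfolding Y_def I_def
    by (auto simp: metrizable_space_prod_topology metrizable_space_subtopology metrizable_space_euclidean)
  define T where "T = (\<lambda>i::nat. if i = 0 then topspace X \<times> {0} else if i = 1 then C \<times> {0..1}
    else topspace X \<times> {1::real})"
  define B where "B = (\<Union>i\<in>{0,1,2}. T i)"
  define f where "f = (\<lambda>y. if fst y \<in> C then h (snd y, fst y) else if snd y = 0 then fst y else c)"
  have clI: "closedin I {0}" "closedin I {1}" "closedin I {0..1}"
    by (auto simp: I_def closedin_closed_subtopology)
  have cloT: "closedin Y (T i)" for i
    unfolding T_def Y_def using clI assms(2) by (auto simp: closedin_prod_Times_iff)
  have cloB: "closedin Y B"
    unfolding B_def by (intro closedin_Union) (auto intro: cloT)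
  define p where "p = (\<lambda>i::nat. if i = 0 then fst else if i = 1 then (\<lambda>y. h (snd y, fst y))
    else (\<lambda>_. c))"
  \<comment> \<open>By \<open>h0\<close> and \<open>h1\<close>, \<open>h\<close> starts as the
    identity and ends as \<open>c\<close>, so the three maps agree with \<open>f\<close>, and hence
    with one another on overlaps, as pasting requires.\<close>
  have pf: "p i y = f y" if "y \<in> T i" for i y
    using that by (auto simp: T_def f_def p_def h0 h1 split: if_split_asm)
  have "continuous_map (subtopology Y B) X f"
  proof (rule pasting_lemma_closed[where I = "{0,1,2}" and T = T and f = p])
    fix i :: nat
    assume "i \<in> {0,1,2}"
    show "closedin (subtopology Y B) (T i)"
      using \<open>i \<in> {0,1,2}\<close> cloT by (intro closedin_subset_topspace) (auto simp: B_def)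
    have "continuous_map (subtopology Y B) X fst"
      unfolding Y_def by (intro continuous_map_from_subtopology continuous_map_fst)
    moreover have "continuous_map (subtopology (subtopology Y B) (T i)) X (\<lambda>y. h (snd y, fst y))"
      if "i = 1"
    proof -
      let ?Z = "subtopology (subtopology Y B) (T i)"
      have "continuous_map ?Z I snd" "continuous_map ?Z X fst"
        unfolding Y_def by (intro continuous_map_from_subtopology continuous_map_fst continuous_map_snd)+
      moreover have "fst \<in> topspace ?Z \<rightarrow> C"
        using that by (auto simp: T_def)
      ultimately have "continuous_map ?Z (prod_topology I (subtopology X C)) (\<lambda>y. (snd y, fst y))"
        by (intro continuous_map_pairedI continuous_map_into_subtopology)
      then show ?thesis
        using continuous_map_compose[OF _ h] by (simp add: o_def)
    qed
    ultimately show "continuous_map (subtopology (subtopology Y B) (T i)) X (p i)"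
      using c by (simp add: p_def continuous_map_from_subtopology)
  next
    fix y
    assume "y \<in> topspace (subtopology Y B)"
    then obtain j where "j \<in> {0,1,2}" "y \<in> T j"
      by (auto simp: B_def)
    then show "\<exists>j. j \<in> {0,1,2} \<and> y \<in> T j \<and> f y = p j y"
      by (metis pf)
  qed (simp_all add: pf)
  then obtain U and g :: "'a \<times> real \<Rightarrow> 'a" where U: "openin Y U" "B \<subseteq> U"
    and g: "continuous_map (subtopology Y U) X g" and gf: "\<And>y. y \<in> B \<Longrightarrow> g y = f y"
    using assms(1)[unfolded ANE_def, THEN conjunct2, rule_format, of Y B f] metY cloB by blast
  define V where "V = {x \<in> topspace X. {x} \<times> {0..1} \<subseteq> U}"
  have "openin X V"
    using openin_prod_topology_tube[OF Icomp U(1)[unfolded Y_def]] by (simp add: V_def Itop)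
  moreover have "C \<subseteq> V"
    using U(2) CX by (auto simp: V_def B_def T_def)
  moreover have "contractible_in X V"
  proof -
    have "continuous_map (prod_topology I (subtopology X V)) (subtopology Y U) (\<lambda>y. (snd y, fst y))"
      unfolding Y_def
    proof (intro continuous_map_into_subtopology continuous_map_pairedI continuous_map_fst)
      show "continuous_map (prod_topology I (subtopology X V)) X snd"
        by (rule continuous_map_into_fulltopology[OF continuous_map_snd])
    qed (auto simp: V_def Itop)
    then have "continuous_map (prod_topology I (subtopology X V)) X (\<lambda>y. g (snd y, fst y))"
      using continuous_map_compose[OF _ g] by (auto simp: o_def)
    \<comment> \<open>Both ends of every segment over \<open>X\<close> belong to \<open>B\<close>,
      so \<open>g\<close> is prescribed there even for \<open>x\<close> outside
      \<open>C\<close>.\<close>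
    moreover have "g (x, 0) = x" "g (x, 1) = c" if "x \<in> V" for x
      using that gf[of "(x, 0)"] gf[of "(x, 1)"] by (auto simp: V_def B_def T_def f_def h0 h1)
    \<comment> \<open>The end conditions for \<open>g\<close> are known only over \<open>V\<close>.
      The rule \<open>homotopic_with\<close> needs them only on the domain, unlike the
      definition.\<close>
    ultimately have "homotopic_with (\<lambda>_. True) (subtopology X V) X id (\<lambda>_. c)"
      unfolding I_def
      by (subst homotopic_with) (auto intro!: exI[of _ "\<lambda>y. g (snd y, fst y)"])
    then show ?thesis
      by (auto simp: contractible_in_def V_def)
  qed
  ultimately show ?thesis
    by blast
qed

theorem proposition3p3:
  fixes X :: "'a topology"
  shows "(normal_space X \<and> category_on X (nu_LS X) \<longrightarrow>
            (\<forall>A. A \<subseteq> topspace X \<longrightarrow> nu_LS X A = nu_H_bar X A)) \<and>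
         (ANE X \<longrightarrow> (\<forall>A. closedin X A \<longrightarrow> nu_LS X A = nu_H X A))"
proof (intro conjI impI allI)
  fix A
  assume "normal_space X \<and> category_on X (nu_LS X)" "A \<subseteq> topspace X"
  then show "nu_LS X A = nu_H_bar X A"
    by (intro antisym nu_LS_le_nu_H_bar nu_H_bar_le_nu_LS category_on_nu_LS_open_neighbourhood) auto
next
  fix A
  assume X: "ANE X" and A: "closedin X A"
  have "normal_space X"
    using X by (simp add: ANE_def metrizable_imp_normal_space)
  then have "nu_LS X A = nu_H_bar X A"
    using A X closedin_subset
    by (intro antisym nu_LS_le_nu_H_bar nu_H_bar_le_nu_LS ANE_open_neighbourhood) auto
  then show "nu_LS X A = nu_H X A"
    by (simp add: nu_H_bar_def A closure_of_closedin)
qed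

end
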